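(* Let $l,T>0$, let $N\ge2$, $j_0\ge1$ be integers, $h=l/N$, $\tau=T/j_0$, $x_i=ih$, $t_j=j\tau$. Let $\alpha:[0,l]\to(0,1)$ be continuous, $\alpha_i=\alpha(x_i)$ for $i=0,\dots,N$, let $k,q,f$ be functions on $\bar Q_T=[0,l]\times[0,T]$ with $k\ge c_1>0$ and $q\ge0$, and let $\beta_1,\beta_2,\mu_1,\mu_2$ be functions on $[0,T]$ with $\beta_1(t),\beta_2(t)\ge\beta_0>0$. Let $0\le\sigma\le1$. Consider the difference scheme for the grid function $y=y_i^j$ ($0\le i\le N$, $0\le j\le j_0$): $$\Delta_{0t_j}^{\alpha_i}y=\Lambda\left(\sigma y^{j+1}+(1-\sigma)y^j\right)+\varphi,\quad i=0,\dots,N,\ j=0,\dots,j_0-1,\qquad y_i^0=u_0(x_i),\quad i=0,\dots,N,$$ with $\Lambda$, $\varphi$, $\Delta_{0t_j}^{\alpha_i}$ as defined in the context. If $$\sigma\ge\frac{1}{3-2^{1-\min_i\alpha_i}},$$ then the scheme is absolutely stable and its solution satisfies, for every $j=0,\dots,j_0-1$, the a priori estimate $$\left[\frac{1}{\Gamma(2-\alpha_i)},\ \sum_{j'=0}^{j}\left(t_{j-j'+1}^{1-\alpha_i}-t_{j-j'}^{1-\alpha_i}\right)(y^{j'+1})^2\right]+\gamma\sum_{j'=0}^{j}\left(\left\|(y_{\bar x}^{(\sigma)})^{j'+1}\right]|_0^2+\left((y_0^{(\sigma)})^{j'+1}\right)^2+\left((y_N^{(\sigma)})^{j'+1}\right)^2\right)\tau$$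 $$\le\frac{\delta}{\gamma}\sum_{j'=0}^{j}\left((\tilde\mu_1^{j'+1/2})^2+(\tilde\mu_2^{j'+1/2})^2+\|\varphi^{j'}\|_0^2\right)\tau+\left[\frac{t_{j+1}^{1-\alpha_i}}{\Gamma(2-\alpha_i)},\ u_0^2(x_i)\right],$$ where $\gamma=\min\{c_1,\beta_0\}$, $\delta=\max\{1+l,l^2\}$ and $(y^{(\sigma)})^{j'+1}=\sigma y^{j'+1}+(1-\sigma)y^{j'}$.
   Context: Notation: $y_t^s=(y^{s+1}-y^s)/\tau$; $y_{\bar x,i}=(y_i-y_{i-1})/h$; $y_{x,i}=(y_{i+1}-y_i)/h$. The discrete Caputo derivative of order $\alpha_i$ is $$\Delta_{0t_j}^{\alpha_i}y=\frac{1}{\Gamma(2-\alpha_i)}\sum_{s=0}^{j}\left(t_{j-s+1}^{1-\alpha_i}-t_{j-s}^{1-\alpha_i}\right)y_t^s .$$ At time level $j$ put $\bar t=t_{j+1/2}=(j+\tfrac12)\tau$, $a_i=k(x_{i-1/2},\bar t)$ with $x_{i-1/2}=(i-\tfrac12)h$ ($1\le i\le N$), $d_i=q(x_i,\bar t)$, $f_i=f(x_i,\bar t)$, and, with $\beta_m,\mu_m$ ($m=1,2$) evaluated at $\bar t$, $$\tilde\beta_1=\beta_1+0.5hd_0,\quad \tilde\beta_2=\beta_2+0.5hd_N,\quad \tilde\mu_1=\mu_1+0.5hf_0,\quad \tilde\mu_2=\mu_2+0.5hf_N;$$ $\tilde\mu_m^{j+1/2}$ denotes the value of $\tilde\mu_m$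 at level $\bar t=t_{j+1/2}$. The operator $\Lambda$ is $$(\Lambda y)_0=\frac{a_1y_{x,0}-\tilde\beta_1y_0}{0.5h},\qquad (\Lambda y)_i=\frac{1}{h}\left(a_{i+1}y_{\bar x,i+1}-a_iy_{\bar x,i}\right)-d_iy_i\ \ (1\le i\le N-1),\qquad (\Lambda y)_N=-\frac{a_Ny_{\bar x,N}+\tilde\beta_2y_N}{0.5h},$$ and $\varphi_0^j=2\tilde\mu_1/h$, $\varphi_i^j=f(x_i,\bar t)$ for $1\le i\le N-1$, $\varphi_N^j=2\tilde\mu_2/h$. Inner products and norms: $(y,v)=\sum_{i=1}^{N-1}y_iv_ih$, $(y,v]=\sum_{i=1}^{N}y_iv_ih$, $[y,v]=\sum_{i=1}^{N-1}y_iv_ih+0.5y_0v_0h+0.5y_Nv_Nh$, $\|y\|_0^2=(y,y)$ (interior nodes only), $\|y]|_0^2=(y,y]$. "Absolutely stable" means stable with respect to the initial data, boundary data and right-hand side (in the sense of the stated a priori estimate) for all grid steps $h,\tau$, with no restriction relating $\tau$ and $h$. Background: the scheme discretizes $\partial_{0t}^{\alpha(x)}u=(ku_x)_x-qu+f$ (Caputo derivative in $t$ of order $\alpha(x)$) on $0<x<l$, $0<t\le T$, with $k(0,t)u_x(0,t)=\beta_1(t)u(0,t)-\mu_1(t)$, $-k(l,t)u_x(l,t)=\beta_2(t)u(l,t)-\mu_2(t)$, $u(x,0)=u_0(x)$; the solution and the data are assumed smooth enough for the scheme to have order of approximation $O(\tau+h^2)$. *)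

theory Defs
  imports "HOL-Analysis.Analysis"
begin

text \<open>
  A grid function of space is a map \<open>v :: nat \<Rightarrow> real\<close> (index \<open>i \<le> N\<close>); a grid function of
  space and time is a map \<open>y :: nat \<Rightarrow> nat \<Rightarrow> real\<close> with \<open>y j i\<close> the value at the node
  \<open>(i h, j \<tau>)\<close>, so the time index comes first.
\<close>

definition diff_t :: "real \<Rightarrow> (nat \<Rightarrow> real) \<Rightarrow> nat \<Rightarrow> real" where
  "diff_t \<tau> w s = (w (s + 1) - w s) / \<tau>"

text \<open>Backward spatial difference; only used at indices \<open>i \<ge> 1\<close>.\<close>

definition diff_xbar :: "real \<Rightarrow> (nat \<Rightarrow> real) \<Rightarrow> nat \<Rightarrow> real" where
  "diff_xbar h v i = (v i - v (i - 1)) / h"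

definition diff_x :: "real \<Rightarrow> (nat \<Rightarrow> real) \<Rightarrow> nat \<Rightarrow> real" where
  "diff_x h v i = (v (i + 1) - v i) / h"

text \<open>
  The increment \<open>t_(n+1)^(1-a) - t_n^(1-a)\<close> with \<open>t_n = n \<tau>\<close>.  For \<open>n = 0\<close> the second
  power is \<open>0\<close>, as it should be for \<open>a < 1\<close>.
\<close>

definition caputo_weight :: "real \<Rightarrow> real \<Rightarrow> nat \<Rightarrow> real" where
  "caputo_weight \<tau> a n = (real (n + 1) * \<tau>) powr (1 - a) - (real n * \<tau>) powr (1 - a)"

definition discrete_caputo :: "real \<Rightarrow> real \<Rightarrow> (nat \<Rightarrow> real) \<Rightarrow> nat \<Rightarrow> real" where
  "discrete_caputo \<tau> a w j =
     1 / Gamma (2 - a) * (\<Sum>s = 0..j. caputo_weight \<tau> a (j - s) * diff_t \<tau> w s)"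

definition t_mid :: "real \<Rightarrow> nat \<Rightarrow> real" where
  "t_mid \<tau> j = (real j + 1 / 2) * \<tau>"

text \<open>
  The tilde modification of boundary data: with \<open>g = q\<close> it turns \<open>\<beta>\<close> into its tilde version,
  with \<open>g = f\<close> it does so for \<open>\<mu>\<close>; \<open>x\<close> is the boundary point and \<open>t\<close> the time.
\<close>

definition tilde :: "real \<Rightarrow> (real \<Rightarrow> real) \<Rightarrow> (real \<Rightarrow> real \<Rightarrow> real) \<Rightarrow> real \<Rightarrow> real \<Rightarrow> real" where
  "tilde h b g x t = b t + 0.5 * h * g x t"

definition Lam ::
  "nat \<Rightarrow> real \<Rightarrow> (real \<Rightarrow> real \<Rightarrow> real) \<Rightarrow> (real \<Rightarrow> real \<Rightarrow> real) \<Rightarrow> (real \<Rightarrow> real) \<Rightarrow> (real \<Rightarrow> real) \<Rightarrow>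
   real \<Rightarrow> (nat \<Rightarrow> real) \<Rightarrow> nat \<Rightarrow> real" where
  "Lam N h k q \<beta>1 \<beta>2 t v i =
     (let a = (\<lambda>m. k ((real m - 1 / 2) * h) t);
          d = (\<lambda>m. q (real m * h) t)
      in if i = 0 then
           (a 1 * diff_x h v 0 - tilde h \<beta>1 q 0 t * v 0) / (0.5 * h)
         else if i = N then
           - ((a N * diff_xbar h v N + tilde h \<beta>2 q (real N * h) t * v N) / (0.5 * h))
         else
           1 / h * (a (i + 1) * diff_xbar h v (i + 1) - a i * diff_xbar h v i) - d i * v i)"

definition phi ::
  "nat \<Rightarrow> real \<Rightarrow> (real \<Rightarrow> real \<Rightarrow> real) \<Rightarrow> (real \<Rightarrow> real) \<Rightarrow> (real \<Rightarrow> real) \<Rightarrow> real \<Rightarrow> nat \<Rightarrow> real" where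
  "phi N h f \<mu>1 \<mu>2 t i =
     (if i = 0 then 2 * tilde h \<mu>1 f 0 t / h
      else if i = N then 2 * tilde h \<mu>2 f (real N * h) t / h
      else f (real i * h) t)"

definition norm0_sq :: "nat \<Rightarrow> real \<Rightarrow> (nat \<Rightarrow> real) \<Rightarrow> real" where
  "norm0_sq N h v = (\<Sum>i = 1..N - 1. v i * v i * h)"

definition norm0_right_sq :: "nat \<Rightarrow> real \<Rightarrow> (nat \<Rightarrow> real) \<Rightarrow> real" where
  "norm0_right_sq N h v = (\<Sum>i = 1..N. v i * v i * h)"

definition inner_closed :: "nat \<Rightarrow> real \<Rightarrow> (nat \<Rightarrow> real) \<Rightarrow> (nat \<Rightarrow> real) \<Rightarrow> real" where
  "inner_closed N h v w =
     (\<Sum>i = 1..N - 1. v i * w i * h) + 0.5 * v 0 * w 0 * h + 0.5 * v N * w N * h"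

text \<open>\<open>weighted \<sigma> y j\<close> is the weighted value belonging to the upper level \<open>j + 1\<close>.\<close>

definition weighted :: "real \<Rightarrow> (nat \<Rightarrow> nat \<Rightarrow> real) \<Rightarrow> nat \<Rightarrow> nat \<Rightarrow> real" where
  "weighted \<sigma> y j i = \<sigma> * y (j + 1) i + (1 - \<sigma>) * y j i"

definition solves_scheme ::
  "nat \<Rightarrow> nat \<Rightarrow> real \<Rightarrow> real \<Rightarrow> (real \<Rightarrow> real) \<Rightarrow> (real \<Rightarrow> real \<Rightarrow> real) \<Rightarrow> (real \<Rightarrow> real \<Rightarrow> real) \<Rightarrow>
   (real \<Rightarrow> real) \<Rightarrow> (real \<Rightarrow> real) \<Rightarrow> real \<Rightarrow>
   (real \<Rightarrow> real \<Rightarrow> real) \<Rightarrow> (real \<Rightarrow> real) \<Rightarrow> (real \<Rightarrow> real) \<Rightarrow> (real \<Rightarrow> real) \<Rightarrow>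
   (nat \<Rightarrow> nat \<Rightarrow> real) \<Rightarrow> bool" where
  "solves_scheme N j0 h \<tau> \<alpha> k q \<beta>1 \<beta>2 \<sigma> f \<mu>1 \<mu>2 u0 y \<longleftrightarrow>
     (\<forall>j<j0. \<forall>i\<le>N.
        discrete_caputo \<tau> (\<alpha> (real i * h)) (\<lambda>s. y s i) j =
        Lam N h k q \<beta>1 \<beta>2 (t_mid \<tau> j) (weighted \<sigma> y j) i + phi N h f \<mu>1 \<mu>2 (t_mid \<tau> j) i) \<and>
     (\<forall>i\<le>N. y 0 i = u0 (real i * h))"

definition apriori_estimate ::
  "nat \<Rightarrow> nat \<Rightarrow> real \<Rightarrow> real \<Rightarrow> (real \<Rightarrow> real) \<Rightarrow> real \<Rightarrow> real \<Rightarrow> real \<Rightarrow>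
   (real \<Rightarrow> real \<Rightarrow> real) \<Rightarrow> (real \<Rightarrow> real) \<Rightarrow> (real \<Rightarrow> real) \<Rightarrow> (real \<Rightarrow> real) \<Rightarrow>
   (nat \<Rightarrow> nat \<Rightarrow> real) \<Rightarrow> bool" where
  "apriori_estimate N j0 h \<tau> \<alpha> \<sigma> \<gamma> \<delta> f \<mu>1 \<mu>2 u0 y \<longleftrightarrow>
     (\<forall>j<j0.
        inner_closed N h
          (\<lambda>i. 1 / Gamma (2 - \<alpha> (real i * h)))
          (\<lambda>i. \<Sum>j' = 0..j. caputo_weight \<tau> (\<alpha> (real i * h)) (j - j') * (y (j' + 1) i)\<^sup>2)
        + \<gamma> * (\<Sum>j' = 0..j.
            (norm0_right_sq N h (diff_xbar h (weighted \<sigma> y j'))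
             + (weighted \<sigma> y j' 0)\<^sup>2 + (weighted \<sigma> y j' N)\<^sup>2) * \<tau>)
        \<le> \<delta> / \<gamma> * (\<Sum>j' = 0..j.
            ((tilde h \<mu>1 f 0 (t_mid \<tau> j'))\<^sup>2 + (tilde h \<mu>2 f (real N * h) (t_mid \<tau> j'))\<^sup>2
             + norm0_sq N h (phi N h f \<mu>1 \<mu>2 (t_mid \<tau> j'))) * \<tau>)
        + inner_closed N h
            (\<lambda>i. (real (j + 1) * \<tau>) powr (1 - \<alpha> (real i * h)) / Gamma (2 - \<alpha> (real i * h)))
            (\<lambda>i. (u0 (real i * h))\<^sup>2))"

text \<open>
  Stability with respect to the initial data, the boundary data and the right-hand side, with
  constants \<open>\<gamma>\<close>, \<open>\<delta>\<close>: the difference of two solutions with different data is controlled, in the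
  sense of the a priori estimate, by the difference of the data.  The stability is absolute when
  this holds on every grid, with \<open>\<gamma>\<close> and \<open>\<delta>\<close> independent of the grid and no relation imposed
  between \<open>\<tau>\<close> and \<open>h\<close>.
\<close>

definition stable_on_grid ::
  "nat \<Rightarrow> nat \<Rightarrow> real \<Rightarrow> real \<Rightarrow> (real \<Rightarrow> real) \<Rightarrow> (real \<Rightarrow> real \<Rightarrow> real) \<Rightarrow> (real \<Rightarrow> real \<Rightarrow> real) \<Rightarrow>
   (real \<Rightarrow> real) \<Rightarrow> (real \<Rightarrow> real) \<Rightarrow> real \<Rightarrow> real \<Rightarrow> real \<Rightarrow> bool" where
  "stable_on_grid N j0 h \<tau> \<alpha> k q \<beta>1 \<beta>2 \<sigma> \<gamma> \<delta> \<longleftrightarrow>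
     (\<forall>f f' \<mu>1 \<mu>1' \<mu>2 \<mu>2' u0 u0' y y'.
        solves_scheme N j0 h \<tau> \<alpha> k q \<beta>1 \<beta>2 \<sigma> f \<mu>1 \<mu>2 u0 y \<longrightarrow>
        solves_scheme N j0 h \<tau> \<alpha> k q \<beta>1 \<beta>2 \<sigma> f' \<mu>1' \<mu>2' u0' y' \<longrightarrow>
        apriori_estimate N j0 h \<tau> \<alpha> \<sigma> \<gamma> \<delta>
          (\<lambda>x t. f x t - f' x t) (\<lambda>t. \<mu>1 t - \<mu>1' t) (\<lambda>t. \<mu>2 t - \<mu>2' t) (\<lambda>x. u0 x - u0' x)
          (\<lambda>j i. y j i - y' j i))"

end

theory Submission
  imports Defs
begin

text \<open>
  Put \<open>z = \<sigma> y\<^sup>j\<^sup>+\<^sup>1 + (1 - \<sigma>) y\<^sup>j\<close> and \<open>R s = (z - y\<^sup>s)\<^sup>2\<close>.  Then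
  \<open>2 z (y\<^sup>s\<^sup>+\<^sup>1 - y\<^sup>s) - ((y\<^sup>s\<^sup>+\<^sup>1)\<^sup>2 - (y\<^sup>s)\<^sup>2) = R s - R (s + 1)\<close>, so Abel summation against the
  monotone Caputo weights, together with the lower bound on \<open>\<sigma>\<close> for the two most recent levels,
  shows that \<open>2 z\<close> times the Caputo difference of \<open>y\<close> dominates the Caputo difference of \<open>y\<^sup>2\<close>.
  Taking the inner product of the scheme with \<open>z\<close>, summing by parts in space, and absorbing the
  right-hand side by Young's inequality with parameter \<open>\<gamma> / \<delta>\<close> and a discrete Poincare inequality
  gives an estimate on each time level; summing it over the levels telescopes the Caputo terms.
  Stability follows by linearity.
\<close>

section \<open>Sign and monotonicity of the Caputo weights\<close>

lemma powr_midpoint_concave: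
  fixes x h p :: real
  assumes "0 \<le> x" "0 \<le> h" "0 \<le> p" "p \<le> 1"
  shows "x powr p + (x + 2 * h) powr p \<le> 2 * (x + h) powr p"
\<comment> \<open>The second-derivative test is applied on the open half-line; at the endpoint
  \<open>x = 0\<close> the claim reduces to \<open>2 powr p \<le> 2\<close>.\<close>
proof (cases "x = 0")
  case True
  have "(2 * h) powr p = 2 powr p * h powr p"
    using assms by (simp add: powr_mult)
  moreover have "2 powr p \<le> (2::real) powr 1"
    using assms by (intro powr_mono) auto
  ultimately show ?thesis
    using True by (simp add: mult_right_mono)
next
  case False
  have "concave_on {0<..} (\<lambda>x::real. x powr p)"
  proof (rule f''_le0_imp_concave)
    fix x :: real assume x: "x \<in> {0<..}"
    show "((\<lambda>x. x powr p) has_real_derivative p * x powr (p - 1)) (at x)"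
      using x by (auto intro!: derivative_eq_intros)
    show "((\<lambda>x. p * x powr (p - 1)) has_real_derivative
        p * ((p - 1) * x powr (p - 1 - 1))) (at x)"
      using x by (auto intro!: derivative_eq_intros)
    show "p * ((p - 1) * x powr (p - 1 - 1)) \<le> 0"
      using assms by (intro mult_nonneg_nonpos mult_nonpos_nonneg) auto
  qed auto
  from concave_onD[OF this, of "1/2" x "x + 2 * h"] False assms
  show ?thesis
    by (simp add: algebra_simps)
qed

lemma caputo_weight_nonneg:
  assumes "0 \<le> \<tau>" "a < 1"
  shows "0 \<le> caputo_weight \<tau> a n"
  unfolding caputo_weight_def using assms
  by (simp add: powr_mono2 mult_right_mono)

text \<open>Midpoint concavity of the power \<open>1 - a\<close> at three consecutive time nodes
  \<open>n * \<tau>\<close>, \<open>(n + 1) * \<tau>\<close>,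
  \<open>(n + 2) * \<tau>\<close>.\<close>

lemma caputo_weight_Suc_le:
  assumes "0 \<le> \<tau>" "0 \<le> a" "a < 1"
  shows "caputo_weight \<tau> a (Suc n) \<le> caputo_weight \<tau> a n"
  using powr_midpoint_concave[of "real n * \<tau>" \<tau> "1 - a"] assms
  unfolding caputo_weight_def by (simp add: algebra_simps)

lemma caputo_weight_antimono:
  assumes "0 \<le> \<tau>" "0 \<le> a" "a < 1"
  shows "antimono (caputo_weight \<tau> a)"
  using caputo_weight_Suc_le[OF assms] by (rule decseq_SucI)

lemma caputo_weight_0: "caputo_weight \<tau> a 0 = \<tau> powr (1 - a)"
  by (simp add: caputo_weight_def)

lemma caputo_weight_1:
  assumes "0 \<le> \<tau>"
  shows "caputo_weight \<tau> a 1 = (2 powr (1 - a) - 1) * \<tau> powr (1 - a)"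
  using assms by (simp add: caputo_weight_def powr_mult algebra_simps)

section \<open>Convolution inequality for the weighted time level\<close>

text \<open>Abel summation rewrites the expression as \<open>c 0 * R 0\<close> plus the sum of
  \<open>(c (s + 1) - c s) * R (s + 1)\<close> over \<open>s < n\<close>, in which every term is
  nonnegative.\<close>

lemma abel_sum_nonneg:
  fixes c R :: "nat \<Rightarrow> real"
  assumes "mono c" "0 \<le> c 0" "\<And>s. 0 \<le> R s"
  shows "0 \<le> (\<Sum>s<n. c s * (R s - R (s + 1))) + c n * R n"
proof (induction n)
  case 0
  then show ?case using assms by simp
next
  case (Suc n)
  have "c n * R (Suc n) \<le> c (Suc n) * R (Suc n)"
    using assms by (intro mult_right_mono) (auto simp: mono_def)
  then show ?case using Suc by (simp add: algebra_simps)
qed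

text \<open>Since \<open>z\<close> need not equal the newest value, \<open>R (j + 1)\<close> need
  not vanish. The Abel sum over \<open>s < j\<close> is nonnegative only after adding
  \<open>w 1 * R j\<close>; the remaining term \<open>w 0 * (R j - R (j + 1))\<close> must pay for
  this, and the lower bound on \<sigma> makes it large enough.\<close>

lemma weighted_convolution_nonneg:
  fixes w v :: "nat \<Rightarrow> real" and \<sigma> :: real and j :: nat
  defines "z \<equiv> \<sigma> * v (j + 1) + (1 - \<sigma>) * v j"
  assumes w: "antimono w" "\<And>n. 0 \<le> w n"
    and \<sigma>: "0 \<le> \<sigma>" "\<sigma> \<le> 1" "w 0 \<le> (2 * w 0 - w 1) * \<sigma>"
  shows "(\<Sum>s\<le>j. w (j - s) * ((v (s + 1))\<^sup>2 - (v s)\<^sup>2))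
       \<le> 2 * z * (\<Sum>s\<le>j. w (j - s) * (v (s + 1) - v s))"
proof -
  define R where "R s = (z - v s)\<^sup>2" for s
  \<comment> \<open>For \<open>s < j\<close> this is \<open>w (j - s)\<close>; at
    \<open>s = j\<close> the maximum selects \<open>w 1\<close> instead of \<open>w 0\<close>, which
    keeps \<open>c\<close> monotone and makes the closing Abel term exactly
    \<open>w 1 * R j\<close>.\<close>
  define c where "c s = w (max 1 (j - s))" for s
  define d where "d = v (j + 1) - v j"
  have "mono c"
    unfolding mono_def c_def
  proof (intro allI impI)
    fix s t :: nat assume "s \<le> t"
    then show "w (max 1 (j - s)) \<le> w (max 1 (j - t))"
      by (intro antimonoD[OF w(1)]) auto
  qed
  then have "0 \<le> (\<Sum>s<j. c s * (R s - R (s + 1))) + c j * R j"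
    by (rule abel_sum_nonneg) (auto simp: c_def R_def w)
  also have "(\<Sum>s<j. c s * (R s - R (s + 1))) = (\<Sum>s<j. w (j - s) * (R s - R (s + 1)))"
    by (intro sum.cong) (auto simp: c_def max_def Suc_le_eq)
  finally have head: "0 \<le> (\<Sum>s<j. w (j - s) * (R s - R (s + 1))) + w 1 * R j"
    by (simp add: c_def)
  have "R j = \<sigma>\<^sup>2 * d\<^sup>2" "R (j + 1) = (1 - \<sigma>)\<^sup>2 * d\<^sup>2"
    by (simp_all add: R_def z_def d_def algebra_simps power2_eq_square)
  then have "w 0 * (R j - R (j + 1)) - w 1 * R j = (w 0 * (2 * \<sigma> - 1) - w 1 * \<sigma>\<^sup>2) * d\<^sup>2"
    by (simp only:) (simp add: algebra_simps power2_eq_square)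
  \<comment> \<open>Replacing the square of \<sigma> by \<sigma> turns the quadratic condition into
    the linear hypothesis on \<sigma>.\<close>
  moreover have "w 1 * \<sigma>\<^sup>2 \<le> w 1 * \<sigma>"
    using \<sigma> w by (intro mult_left_mono) (auto simp: power2_eq_square mult_left_le)
  then have "0 \<le> w 0 * (2 * \<sigma> - 1) - w 1 * \<sigma>\<^sup>2"
    using \<sigma>(3) by (simp add: algebra_simps)
  ultimately have last: "0 \<le> w 0 * (R j - R (j + 1)) - w 1 * R j"
    by simp
  have "0 \<le> (\<Sum>s<j. w (j - s) * (R s - R (s + 1))) + w 0 * (R j - R (j + 1))"
    using head last by linarith
  also have "\<dots> = (\<Sum>s\<le>j. w (j - s) * (R s - R (s + 1)))"
    by (simp flip: lessThan_Suc_atMost)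
  also have "\<dots> = (\<Sum>s\<le>j. 2 * z * (w (j - s) * (v (s + 1) - v s))
                     - w (j - s) * ((v (s + 1))\<^sup>2 - (v s)\<^sup>2))"
    by (intro sum.cong) (auto simp: R_def algebra_simps power2_eq_square)
  also have "\<dots> = 2 * z * (\<Sum>s\<le>j. w (j - s) * (v (s + 1) - v s))
                     - (\<Sum>s\<le>j. w (j - s) * ((v (s + 1))\<^sup>2 - (v s)\<^sup>2))"
    by (simp add: sum_subtractf sum_distrib_left)
  finally show ?thesis by simp
qed

section \<open>The discrete Caputo derivative: square inequality and telescoping in time\<close>

lemma discrete_caputo_alt:
  "discrete_caputo \<tau> a v j =
    1 / (Gamma (2 - a) * \<tau>) * (\<Sum>s\<le>j. caputo_weight \<tau> a (j - s) * (v (s + 1) - v s))"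
  by (simp add: discrete_caputo_def diff_t_def atLeast0AtMost flip: sum_divide_distrib)

text \<open>The origin of the threshold: the ratio of \<open>caputo_weight \<tau> a 1\<close> to
  \<open>caputo_weight \<tau> a 0\<close> is \<open>2 powr (1 - a) - 1\<close>, so the bound on
  \<sigma> is the condition \<open>w 0 \<le> (2 * w 0 - w 1) * \<sigma>\<close> of the convolution
  inequality.\<close>

lemma discrete_caputo_square_le:
  assumes "0 < \<tau>" "0 < a" "a < 1" "\<sigma> \<le> 1" "1 / (3 - 2 powr (1 - a)) \<le> \<sigma>"
  shows "discrete_caputo \<tau> a (\<lambda>s. (v s)\<^sup>2) j
       \<le> 2 * discrete_caputo \<tau> a v j * (\<sigma> * v (j + 1) + (1 - \<sigma>) * v j)"
proof -
  let ?w = "caputo_weight \<tau> a"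
  have "2 powr (1 - a) < (2::real) powr 1"
    using assms by (intro powr_less_mono) auto
  then have pos: "0 < 3 - 2 powr (1 - a)" by simp
  with assms(5) have "1 \<le> \<sigma> * (3 - 2 powr (1 - a))"
    by (simp add: divide_le_eq)
  then have "?w 0 * 1 \<le> ?w 0 * (\<sigma> * (3 - 2 powr (1 - a)))"
    using assms by (intro mult_left_mono caputo_weight_nonneg) auto
  also have "?w 0 * (\<sigma> * (3 - 2 powr (1 - a))) = (2 * ?w 0 - ?w 1) * \<sigma>"
    using assms caputo_weight_1[of \<tau> a] by (simp only: caputo_weight_0) (simp add: algebra_simps)
  finally have w: "?w 0 \<le> (2 * ?w 0 - ?w 1) * \<sigma>" by simp
  have "0 \<le> \<sigma>"
    using pos assms(5) by (meson divide_nonneg_pos le_less_trans linorder_not_less zero_le_one order_trans)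
  from weighted_convolution_nonneg[OF caputo_weight_antimono caputo_weight_nonneg this assms(4) w,
      where v = v and j = j] assms
  have "(\<Sum>s\<le>j. ?w (j - s) * ((v (s + 1))\<^sup>2 - (v s)\<^sup>2))
       \<le> 2 * (\<sigma> * v (j + 1) + (1 - \<sigma>) * v j) * (\<Sum>s\<le>j. ?w (j - s) * (v (s + 1) - v s))"
    by simp
  moreover have "0 \<le> 1 / (Gamma (2 - a) * \<tau>)"
    using assms by (simp add: Gamma_real_pos less_imp_le)
  ultimately have "1 / (Gamma (2 - a) * \<tau>) * (\<Sum>s\<le>j. ?w (j - s) * ((v (s + 1))\<^sup>2 - (v s)\<^sup>2))
       \<le> 1 / (Gamma (2 - a) * \<tau>) * (2 * (\<sigma> * v (j + 1) + (1 - \<sigma>) * v j)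
          * (\<Sum>s\<le>j. ?w (j - s) * (v (s + 1) - v s)))"
    by (rule mult_left_mono)
  then show ?thesis
    unfolding discrete_caputo_alt by (simp only: ac_simps)
qed

text \<open>Each Caputo value times \<tau> is, up to the Gamma factor, a difference of two
  convolutions with indices shifted by one. These cancel between consecutive levels, and only the
  weights at \<open>v 0\<close> accumulate; they telescope to a power of the final time.\<close>

lemma sum_discrete_caputo:
  assumes "\<tau> \<noteq> 0"
  shows "(\<Sum>j\<le>n. discrete_caputo \<tau> a v j * \<tau>) =
    1 / Gamma (2 - a) * ((\<Sum>s\<le>n. caputo_weight \<tau> a (n - s) * v (s + 1))
      - (real (n + 1) * \<tau>) powr (1 - a) * v 0)"
proof (induction n)
  case 0
  show ?case
    using assms by (simp add: discrete_caputo_alt caputo_weight_0 algebra_simps)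
next
  case (Suc n)
  let ?w = "caputo_weight \<tau> a" and ?G = "1 / Gamma (2 - a)"
  \<comment> \<open>Splitting off \<open>s = 0\<close> and shifting exposes the convolution of level
    \<open>n\<close>, which cancels against the induction hypothesis.\<close>
  have "(\<Sum>s\<le>Suc n. ?w (Suc n - s) * v s) = ?w (Suc n) * v 0 + (\<Sum>s\<le>n. ?w (n - s) * v (s + 1))"
    by (subst sum.atMost_Suc_shift) simp
  moreover have "?w (Suc n) = (real (Suc n + 1) * \<tau>) powr (1 - a) - (real (n + 1) * \<tau>) powr (1 - a)"
    by (simp add: caputo_weight_def)
  moreover have "discrete_caputo \<tau> a v (Suc n) * \<tau> =
      ?G * ((\<Sum>s\<le>Suc n. ?w (Suc n - s) * v (s + 1)) - (\<Sum>s\<le>Suc n. ?w (Suc n - s) * v s))"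
    by (simp only: discrete_caputo_alt right_diff_distrib[of "?w _"] sum_subtractf)
      (simp only: times_divide_eq_left times_divide_eq_right mult_1_left mult_1_right
        nonzero_mult_divide_mult_cancel_right[OF assms])
  ultimately show ?case
    by (simp only: sum.atMost_Suc[where g = "\<lambda>j. discrete_caputo \<tau> a v j * \<tau>"] Suc.IH)
      (simp only: algebra_simps)
qed

section \<open>Algebra of the closed inner product\<close>

lemma inner_closed_mono:
  assumes "0 \<le> h" "\<And>i. i \<le> N \<Longrightarrow> v i * w i \<le> v' i * w' i"
  shows "inner_closed N h v w \<le> inner_closed N h v' w'"
proof -
  have "(\<Sum>i = 1..N - 1. v i * w i * h) \<le> (\<Sum>i = 1..N - 1. v' i * w' i * h)"
    using assms by (intro sum_mono mult_right_mono) auto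
  moreover have "v 0 * w 0 * h \<le> v' 0 * w' 0 * h" "v N * w N * h \<le> v' N * w' N * h"
    using assms by (auto intro!: mult_right_mono)
  ultimately show ?thesis
    by (simp add: inner_closed_def)
qed

lemma inner_closed_cong:
  assumes "\<And>i. i \<le> N \<Longrightarrow> v i * w i = v' i * w' i"
  shows "inner_closed N h v w = inner_closed N h v' w'"
proof -
  have "(\<Sum>i = 1..N - 1. v i * w i * h) = (\<Sum>i = 1..N - 1. v' i * w' i * h)"
    using assms by (intro sum.cong) auto
  moreover have "v 0 * w 0 = v' 0 * w' 0" "v N * w N = v' N * w' N"
    using assms by auto
  ultimately show ?thesis
    by (simp add: inner_closed_def mult.assoc)
qed

lemma inner_closed_add_left:
  "inner_closed N h (\<lambda>i. u i + v i) w = inner_closed N h u w + inner_closed N h v w"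
  by (simp add: inner_closed_def algebra_simps sum.distrib add_divide_distrib)

lemma inner_closed_diff_right:
  "inner_closed N h v (\<lambda>i. u i - w i) = inner_closed N h v u - inner_closed N h v w"
  by (simp add: inner_closed_def algebra_simps sum_subtractf diff_divide_distrib)

lemma inner_closed_scale_left:
  "inner_closed N h (\<lambda>i. c * v i) w = c * inner_closed N h v w"
  by (simp add: inner_closed_def algebra_simps sum_distrib_left)

lemma inner_closed_sum_left:
  "inner_closed N h (\<lambda>i. \<Sum>j\<in>J. v j i) w = (\<Sum>j\<in>J. inner_closed N h (v j) w)"
  by (induction J rule: infinite_finite_induct)
    (auto simp: inner_closed_add_left inner_closed_def[of _ _ "\<lambda>_. 0"])

section \<open>Summation by parts and the discrete Green formula\<close>

lemma summation_by_parts: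
  fixes A v :: "nat \<Rightarrow> 'a :: comm_ring_1"
  shows "(\<Sum>i = 1..n. (A (i + 1) - A i) * v i) =
    A (n + 1) * v (n + 1) - A 1 * v 0 - (\<Sum>i = 1..n + 1. A i * (v i - v (i - 1)))"
  by (induction n) (simp_all add: algebra_simps)

text \<open>The boundary weights \<open>0.5 * h\<close> of the inner product cancel the divisors
  \<open>0.5 * h\<close> in the boundary rows of \<open>Lam\<close>. The fluxes in these rows then
  cancel the boundary terms of the summation by parts.\<close>

lemma inner_closed_Lam:
  assumes "h \<noteq> 0" "1 \<le> N"
  shows "inner_closed N h (Lam N h k q \<beta>1 \<beta>2 t v) v =
    - (\<Sum>i = 1..N. k ((real i - 1 / 2) * h) t * (diff_xbar h v i)\<^sup>2 * h)
    - (\<Sum>i = 1..N - 1. q (real i * h) t * (v i)\<^sup>2 * h)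
    - tilde h \<beta>1 q 0 t * (v 0)\<^sup>2 - tilde h \<beta>2 q (real N * h) t * (v N)\<^sup>2"
proof -
  \<comment> \<open>The flux through the midpoint of the cell between nodes \<open>i - 1\<close> and
    \<open>i\<close>; interior rows of \<open>Lam\<close> are differences of neighbouring
    fluxes.\<close>
  define A where "A i = k ((real i - 1 / 2) * h) t * diff_xbar h v i" for i
  obtain M where N: "N = Suc M"
    using assms(2) by (cases N) auto
  have "(\<Sum>i = 1..M. Lam N h k q \<beta>1 \<beta>2 t v i * v i * h) =
      (\<Sum>i = 1..M. (A (i + 1) - A i) * v i - q (real i * h) t * (v i)\<^sup>2 * h)"
    using assms(1) N
    by (intro sum.cong refl)
      (simp add: Lam_def Let_def A_def field_simps power2_eq_square)
  also have "\<dots> = A N * v N - A 1 * v 0 - (\<Sum>i = 1..N. A i * (v i - v (i - 1)))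
      - (\<Sum>i = 1..M. q (real i * h) t * (v i)\<^sup>2 * h)"
    unfolding sum_subtractf summation_by_parts by (simp add: N)
  also have "(\<Sum>i = 1..N. A i * (v i - v (i - 1))) =
      (\<Sum>i = 1..N. k ((real i - 1 / 2) * h) t * (diff_xbar h v i)\<^sup>2 * h)"
    using assms(1) by (intro sum.cong refl) (simp add: A_def diff_xbar_def power2_eq_square)
  finally have "(\<Sum>i = 1..N - 1. Lam N h k q \<beta>1 \<beta>2 t v i * v i * h) = A N * v N - A 1 * v 0
      - (\<Sum>i = 1..N. k ((real i - 1 / 2) * h) t * (diff_xbar h v i)\<^sup>2 * h)
      - (\<Sum>i = 1..N - 1. q (real i * h) t * (v i)\<^sup>2 * h)"
    by (simp add: N)
  moreover have "0.5 * Lam N h k q \<beta>1 \<beta>2 t v 0 * v 0 * h = A 1 * v 0 - tilde h \<beta>1 q 0 t * (v 0)\<^sup>2"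
    using assms(1)
    by (simp add: Lam_def A_def diff_x_def diff_xbar_def field_simps power2_eq_square)
  moreover have "0.5 * Lam N h k q \<beta>1 \<beta>2 t v N * v N * h
      = - A N * v N - tilde h \<beta>2 q (real N * h) t * (v N)\<^sup>2"
    using assms by (simp add: Lam_def Let_def A_def field_simps power2_eq_square)
  ultimately show ?thesis
    unfolding inner_closed_def by linarith
qed

section \<open>Absorption of the right-hand side\<close>

lemma inner_closed_phi:
  assumes "h \<noteq> 0" "1 \<le> N"
  shows "inner_closed N h (phi N h f \<mu>1 \<mu>2 t) v =
    (\<Sum>i = 1..N - 1. phi N h f \<mu>1 \<mu>2 t i * v i * h)
    + tilde h \<mu>1 f 0 t * v 0 + tilde h \<mu>2 f (real N * h) t * v N"
  using assms by (simp add: inner_closed_def phi_def)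

text \<open>Averaging the representations of \<open>v i\<close> from both ends avoids a factor \<open>2\<close> in front of
  the boundary values.\<close>

lemma square_le_boundary_plus_gradient:
  assumes "0 < h" "i \<le> N"
  shows "(v i)\<^sup>2 \<le> (v 0)\<^sup>2 + (v N)\<^sup>2 + real N * h / 2 * norm0_right_sq N h (diff_xbar h v)"
proof -
  define D where "D m = v m - v (m - 1)" for m
  have "v i - v 0 = (\<Sum>m = 1..i. D m)"
    unfolding D_def using sum_telescope''[of 0 i v] by simp
  moreover have "v N - v i = (\<Sum>m = Suc i..N. D m)"
    unfolding D_def using sum_telescope''[OF assms(2), of v] by simp
  ultimately have "\<bar>(v i - v 0) - (v N - v i)\<bar> \<le> (\<Sum>m = 1..i. \<bar>D m\<bar>) + (\<Sum>m = Suc i..N. \<bar>D m\<bar>)"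
    using sum_abs[of D "{1..i}"] sum_abs[of D "{Suc i..N}"] by linarith
  also have "\<dots> = (\<Sum>m = 1..N. \<bar>D m\<bar>)"
    using sum.ub_add_nat[of 1 i "\<lambda>m. \<bar>D m\<bar>" "N - i"] assms by simp
  finally have "((v i - v 0) - (v N - v i))\<^sup>2 \<le> (\<Sum>m = 1..N. \<bar>D m\<bar>)\<^sup>2"
    by (metis abs_le_square_iff abs_of_nonneg sum_nonneg abs_ge_zero)
  also have "\<dots> \<le> (\<Sum>m = 1..N. \<bar>D m\<bar>\<^sup>2) * real N"
    using sum_squared_le_sum_of_squares[of "\<lambda>m. \<bar>D m\<bar>" "{1..N}"] by simp
  also have "(\<Sum>m = 1..N. \<bar>D m\<bar>\<^sup>2) = h * norm0_right_sq N h (diff_xbar h v)"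
    using assms unfolding norm0_right_sq_def sum_distrib_left
    by (intro sum.cong refl) (simp add: D_def diff_xbar_def power2_eq_square)
  finally have "(2 * v i - (v 0 + v N))\<^sup>2 \<le> real N * h * norm0_right_sq N h (diff_xbar h v)"
    by (simp add: algebra_simps)
  \<comment> \<open>With \<open>s = v 0 + v N\<close>, the right side minus the left side is the
    square of \<open>2 * v i - 2 * s\<close>.\<close>
  moreover have "4 * (v i)\<^sup>2 \<le> 2 * (2 * v i - (v 0 + v N))\<^sup>2 + 2 * (v 0 + v N)\<^sup>2"
    using zero_le_power2[of "2 * v i - 2 * (v 0 + v N)"]
    by (simp add: power2_eq_square algebra_simps)
  moreover have "(v 0 + v N)\<^sup>2 \<le> 2 * (v 0)\<^sup>2 + 2 * (v N)\<^sup>2"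
    using zero_le_power2[of "v 0 - v N"] by (simp add: power2_eq_square algebra_simps)
  ultimately show ?thesis by simp
qed

text \<open>The pointwise bound is summed over interior nodes of total weight at most
  \<open>l\<close>: this gives the factor \<open>l\<close> at the boundary squares, hence
  \<open>1 + l\<close> after adding them once more, and half of \<open>l\<^sup>2\<close> at the
  gradient.\<close>

lemma discrete_poincare:
  fixes l :: real
  assumes "0 < h" "l = real N * h"
  shows "norm0_sq N h v + (v 0)\<^sup>2 + (v N)\<^sup>2 \<le> max (1 + l) (l\<^sup>2) *
    (norm0_right_sq N h (diff_xbar h v) + (v 0)\<^sup>2 + (v N)\<^sup>2)"
proof -
  let ?g = "norm0_right_sq N h (diff_xbar h v)" and ?b = "(v 0)\<^sup>2 + (v N)\<^sup>2"
  have l: "0 \<le> l" and g: "0 \<le> ?g"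
    using assms by (auto simp: norm0_right_sq_def intro!: sum_nonneg)
  have "norm0_sq N h v \<le> (\<Sum>i = 1..N - 1. (?b + l / 2 * ?g) * h)"
    unfolding norm0_sq_def assms(2)
    using assms(1) square_le_boundary_plus_gradient[OF assms(1), of _ N v]
    by (intro sum_mono mult_right_mono) (auto simp: power2_eq_square)
  also have "\<dots> = (real (N - 1) * h) * (?b + l / 2 * ?g)"
    by simp
  also have "\<dots> \<le> l * (?b + l / 2 * ?g)"
    unfolding assms(2) using assms(1) g by (intro mult_right_mono) auto
  finally have "norm0_sq N h v + ?b \<le> (1 + l) * ?b + l\<^sup>2 / 2 * ?g"
    by (simp add: algebra_simps power2_eq_square)
  also have "\<dots> \<le> max (1 + l) (l\<^sup>2) * ?b + max (1 + l) (l\<^sup>2) * ?g"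
    using g by (intro add_mono mult_right_mono) (auto simp: le_max_iff_disj)
  finally show ?thesis
    by (simp add: algebra_simps)
qed

lemma young_two_products:
  fixes a b e :: real
  assumes "0 < e"
  shows "2 * (a * b) \<le> e * b\<^sup>2 + 1 / e * a\<^sup>2"
proof -
  have "0 \<le> (e * b - a)\<^sup>2 / e" using assms by simp
  also have "\<dots> = e * b\<^sup>2 + 1 / e * a\<^sup>2 - 2 * (a * b)"
    using assms by (simp add: power2_eq_square field_simps)
  finally show ?thesis by simp
qed

lemma inner_closed_phi_le:
  fixes l :: real
  assumes "0 < h" "1 \<le> N" "l = real N * h" "0 < \<gamma>" "\<delta> = max (1 + l) (l\<^sup>2)"
  shows "2 * inner_closed N h (phi N h f \<mu>1 \<mu>2 t) v
    \<le> \<gamma> * (norm0_right_sq N h (diff_xbar h v) + (v 0)\<^sup>2 + (v N)\<^sup>2)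
      + \<delta> / \<gamma> * ((tilde h \<mu>1 f 0 t)\<^sup>2 + (tilde h \<mu>2 f (real N * h) t)\<^sup>2
        + norm0_sq N h (phi N h f \<mu>1 \<mu>2 t))"
proof -
  let ?\<phi> = "phi N h f \<mu>1 \<mu>2 t"
  \<comment> \<open>The Young parameter is chosen so that the Poincare constant \<delta> turns
    \<open>e\<close> into \<gamma>, while the reciprocal \<open>1 / e\<close> is the factor
    \<open>\<delta> / \<gamma>\<close> at the data.\<close>
  define e where "e = \<gamma> / \<delta>"
  have \<delta>: "0 < \<delta>" and e: "0 < e"
    using assms by (auto simp: e_def less_max_iff_disj add_pos_nonneg)
  have "2 * (\<Sum>i = 1..N - 1. ?\<phi> i * v i * h)
      = (\<Sum>i = 1..N - 1. 2 * (?\<phi> i * v i) * h)"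
    by (simp add: sum_distrib_left mult.assoc)
  also have "\<dots> \<le> (\<Sum>i = 1..N - 1. (e * (v i)\<^sup>2 + 1 / e * (?\<phi> i)\<^sup>2) * h)"
    using assms(1) by (intro sum_mono mult_right_mono young_two_products e) auto
  also have "\<dots> = e * norm0_sq N h v + 1 / e * norm0_sq N h ?\<phi>"
    by (simp add: norm0_sq_def sum.distrib sum_distrib_left power2_eq_square algebra_simps)
  finally have "2 * inner_closed N h ?\<phi> v \<le> e * (norm0_sq N h v + (v 0)\<^sup>2 + (v N)\<^sup>2)
      + 1 / e * ((tilde h \<mu>1 f 0 t)\<^sup>2 + (tilde h \<mu>2 f (real N * h) t)\<^sup>2 + norm0_sq N h ?\<phi>)"
    using inner_closed_phi[of h N f \<mu>1 \<mu>2 t v] assms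
      young_two_products[OF e, of "tilde h \<mu>1 f 0 t" "v 0"]
      young_two_products[OF e, of "tilde h \<mu>2 f (real N * h) t" "v N"]
    by (simp add: algebra_simps)
  moreover have "e * (norm0_sq N h v + (v 0)\<^sup>2 + (v N)\<^sup>2)
      \<le> e * (\<delta> * (norm0_right_sq N h (diff_xbar h v) + (v 0)\<^sup>2 + (v N)\<^sup>2))"
    using discrete_poincare[OF assms(1,3)] e assms(5) by (intro mult_left_mono) auto
  moreover have "e * (\<delta> * X) = \<gamma> * X" for X
    using \<delta> by (simp add: e_def)
  moreover have "1 / e = \<delta> / \<gamma>"
    by (simp add: e_def)
  ultimately show ?thesis by simp
qed

section \<open>Coercivity and the energy estimate\<close>

text \<open>Coercivity from the Green formula: the lower bounds on \<open>k\<close>, \<beta>1,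
  \<beta>2 control gradient and boundary terms, and \<open>q \<ge> 0\<close> both makes the reaction
  term dissipative and keeps the tilde coefficients above \<gamma>.\<close>

lemma inner_closed_Lam_le:
  assumes "0 < h" "1 \<le> N"
    and "\<And>x. x \<in> {0..real N * h} \<Longrightarrow> \<gamma> \<le> k x t"
    and "\<And>x. x \<in> {0..real N * h} \<Longrightarrow> 0 \<le> q x t"
    and "\<gamma> \<le> \<beta>1 t" "\<gamma> \<le> \<beta>2 t"
  shows "inner_closed N h (Lam N h k q \<beta>1 \<beta>2 t v) v
    \<le> - \<gamma> * (norm0_right_sq N h (diff_xbar h v) + (v 0)\<^sup>2 + (v N)\<^sup>2)"
proof -
  have node: "real i * h \<in> {0..real N * h}" if "i \<le> N" for i
    using assms(1) that by auto
  have "(\<Sum>i = 1..N. \<gamma> * (diff_xbar h v i)\<^sup>2 * h)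
      \<le> (\<Sum>i = 1..N. k ((real i - 1 / 2) * h) t * (diff_xbar h v i)\<^sup>2 * h)"
    using assms(1) by (intro sum_mono mult_right_mono assms(3)) auto
  then have "\<gamma> * norm0_right_sq N h (diff_xbar h v)
      \<le> (\<Sum>i = 1..N. k ((real i - 1 / 2) * h) t * (diff_xbar h v i)\<^sup>2 * h)"
    by (simp add: norm0_right_sq_def sum_distrib_left power2_eq_square mult.assoc)
  moreover have "0 \<le> (\<Sum>i = 1..N - 1. q (real i * h) t * (v i)\<^sup>2 * h)"
    using assms(1) by (intro sum_nonneg mult_nonneg_nonneg assms(4) node) auto
  moreover have "\<gamma> \<le> tilde h \<beta>1 q 0 t" "\<gamma> \<le> tilde h \<beta>2 q (real N * h) t"
    using assms(1,5,6) assms(4)[OF node[of 0]] assms(4)[OF node[of N]]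
    by (simp_all add: tilde_def add_increasing2)
  then have "\<gamma> * (v 0)\<^sup>2 \<le> tilde h \<beta>1 q 0 t * (v 0)\<^sup>2"
    "\<gamma> * (v N)\<^sup>2 \<le> tilde h \<beta>2 q (real N * h) t * (v N)\<^sup>2"
    by (simp_all add: mult_right_mono)
  ultimately show ?thesis
    using inner_closed_Lam[of h N k q \<beta>1 \<beta>2 t v] assms(1,2) by (simp add: algebra_simps)
qed

text \<open>The order \<open>a i\<close> varies with the node, so telescoping is done node by node
  under the inner product. Pairing with the constant \<open>1\<close> lets the Gamma factor be moved
  into the weight afterwards.\<close>

lemma sum_inner_closed_caputo:
  assumes "\<tau> \<noteq> 0"
  shows "(\<Sum>j\<le>n. inner_closed N h (\<lambda>i. discrete_caputo \<tau> (a i) (\<lambda>s. y s i) j) (\<lambda>_. 1) * \<tau>) =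
    inner_closed N h (\<lambda>i. 1 / Gamma (2 - a i))
      (\<lambda>i. \<Sum>s\<le>n. caputo_weight \<tau> (a i) (n - s) * y (s + 1) i)
    - inner_closed N h (\<lambda>i. (real (n + 1) * \<tau>) powr (1 - a i) / Gamma (2 - a i)) (y 0)"
proof -
  have "(\<Sum>j\<le>n. inner_closed N h (\<lambda>i. discrete_caputo \<tau> (a i) (\<lambda>s. y s i) j) (\<lambda>_. 1) * \<tau>) =
      inner_closed N h (\<lambda>i. \<Sum>j\<le>n. \<tau> * discrete_caputo \<tau> (a i) (\<lambda>s. y s i) j) (\<lambda>_. 1)"
    unfolding inner_closed_sum_left inner_closed_scale_left by (simp add: mult.commute)
  also have "\<dots> = inner_closed N h (\<lambda>i. 1 / Gamma (2 - a i))
      (\<lambda>i. (\<Sum>s\<le>n. caputo_weight \<tau> (a i) (n - s) * y (s + 1) i)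
        - (real (n + 1) * \<tau>) powr (1 - a i) * y 0 i)"
    using sum_discrete_caputo[OF assms]
    by (intro inner_closed_cong) (simp add: mult.commute[of \<tau>])
  also have "\<dots> = inner_closed N h (\<lambda>i. 1 / Gamma (2 - a i))
      (\<lambda>i. \<Sum>s\<le>n. caputo_weight \<tau> (a i) (n - s) * y (s + 1) i)
    - inner_closed N h (\<lambda>i. 1 / Gamma (2 - a i)) (\<lambda>i. (real (n + 1) * \<tau>) powr (1 - a i) * y 0 i)"
    by (rule inner_closed_diff_right)
  also have "inner_closed N h (\<lambda>i. 1 / Gamma (2 - a i)) (\<lambda>i. (real (n + 1) * \<tau>) powr (1 - a i) * y 0 i)
    = inner_closed N h (\<lambda>i. (real (n + 1) * \<tau>) powr (1 - a i) / Gamma (2 - a i)) (y 0)"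
    by (intro inner_closed_cong) simp
  finally show ?thesis .
qed

lemma apriori_estimate_if_solves_scheme:
  fixes l :: real
  assumes "0 < h" "0 < \<tau>" "1 \<le> N" "l = real N * h" "T = real j0 * \<tau>"
    and \<alpha>: "\<And>x. x \<in> {0..l} \<Longrightarrow> 0 < \<alpha> x \<and> \<alpha> x < 1"
    and k: "\<And>x t. x \<in> {0..l} \<Longrightarrow> t \<in> {0..T} \<Longrightarrow> \<gamma> \<le> k x t"
    and q: "\<And>x t. x \<in> {0..l} \<Longrightarrow> t \<in> {0..T} \<Longrightarrow> 0 \<le> q x t"
    and \<beta>: "\<And>t. t \<in> {0..T} \<Longrightarrow> \<gamma> \<le> \<beta>1 t" "\<And>t. t \<in> {0..T} \<Longrightarrow> \<gamma> \<le> \<beta>2 t"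
    and "\<sigma> \<le> 1"
    and \<sigma>: "\<And>i. i \<le> N \<Longrightarrow> 1 / (3 - 2 powr (1 - \<alpha> (real i * h))) \<le> \<sigma>"
    and "0 < \<gamma>" "\<delta> = max (1 + l) (l\<^sup>2)"
    and y: "solves_scheme N j0 h \<tau> \<alpha> k q \<beta>1 \<beta>2 \<sigma> f \<mu>1 \<mu>2 u0 y"
  shows "apriori_estimate N j0 h \<tau> \<alpha> \<sigma> \<gamma> \<delta> f \<mu>1 \<mu>2 u0 y"
  unfolding apriori_estimate_def
proof (intro allI impI)
  fix j assume j: "j < j0"
  define E where "E n = norm0_right_sq N h (diff_xbar h (weighted \<sigma> y n))
    + (weighted \<sigma> y n 0)\<^sup>2 + (weighted \<sigma> y n N)\<^sup>2" for n
  define D where "D n = (tilde h \<mu>1 f 0 (t_mid \<tau> n))\<^sup>2 + (tilde h \<mu>2 f (real N * h) (t_mid \<tau> n))\<^sup>2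
    + norm0_sq N h (phi N h f \<mu>1 \<mu>2 (t_mid \<tau> n))" for n
  define C where "C n = inner_closed N h
    (\<lambda>i. discrete_caputo \<tau> (\<alpha> (real i * h)) (\<lambda>s. (y s i)\<^sup>2) n) (\<lambda>_. 1)" for n
  have level: "C n + \<gamma> * E n \<le> \<delta> / \<gamma> * D n" if "n < j0" for n
  proof -
    let ?z = "weighted \<sigma> y n" and ?t = "t_mid \<tau> n"
    let ?Lam = "Lam N h k q \<beta>1 \<beta>2 ?t ?z" and ?phi = "phi N h f \<mu>1 \<mu>2 ?t"
    \<comment> \<open>As \<open>n < j0\<close>, the half-integer level stays within the time
      interval on which the coefficient bounds hold.\<close>
    have "(real n + 1 / 2) * \<tau> \<le> real j0 * \<tau>"
      using that assms(2) by (intro mult_right_mono) auto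
    then have t: "?t \<in> {0..T}"
      using assms(2) by (simp add: t_mid_def assms(5))
    have "C n \<le> inner_closed N h (\<lambda>i. 2 * (?Lam i + ?phi i)) ?z"
      unfolding C_def
    proof (rule inner_closed_mono)
      fix i assume i: "i \<le> N"
      then have "real i * h \<in> {0..l}"
        using assms(1) by (auto simp: assms(4))
      from discrete_caputo_square_le[OF assms(2) _ _ \<open>\<sigma> \<le> 1\<close> \<sigma>[OF i], of "\<lambda>s. y s i" n] \<alpha>[OF this]
      have "discrete_caputo \<tau> (\<alpha> (real i * h)) (\<lambda>s. (y s i)\<^sup>2) n
        \<le> 2 * discrete_caputo \<tau> (\<alpha> (real i * h)) (\<lambda>s. y s i) n * ?z i"
        by (simp add: weighted_def)
      also have "discrete_caputo \<tau> (\<alpha> (real i * h)) (\<lambda>s. y s i) n = ?Lam i + ?phi i"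
        using y that i by (simp add: solves_scheme_def)
      finally show "discrete_caputo \<tau> (\<alpha> (real i * h)) (\<lambda>s. (y s i)\<^sup>2) n * 1
        \<le> 2 * (?Lam i + ?phi i) * ?z i"
        by simp
    qed (use assms(1) in simp)
    also have "\<dots> = 2 * inner_closed N h ?Lam ?z + 2 * inner_closed N h ?phi ?z"
      by (simp add: inner_closed_scale_left inner_closed_add_left)
    \<comment> \<open>Coercivity yields two copies of \<open>\<gamma> * E n\<close>; the data term
      consumes one and the other remains on the left of the estimate.\<close>
    also have "\<dots> \<le> 2 * (- \<gamma> * E n) + (\<gamma> * E n + \<delta> / \<gamma> * D n)"
      unfolding E_def D_def
      using t k q \<beta> assms(1,3,4,13,14)
      by (intro add_mono mult_left_mono inner_closed_Lam_le inner_closed_phi_le) auto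
    finally show ?thesis by simp
  qed
  have "(\<Sum>n\<le>j. C n * \<tau>) + \<gamma> * (\<Sum>n\<le>j. E n * \<tau>) = (\<Sum>n\<le>j. (C n + \<gamma> * E n) * \<tau>)"
    by (simp add: sum.distrib sum_distrib_left algebra_simps)
  also have "\<dots> \<le> (\<Sum>n\<le>j. \<delta> / \<gamma> * D n * \<tau>)"
    using level j assms(2) by (intro sum_mono mult_right_mono) auto
  also have "\<dots> = \<delta> / \<gamma> * (\<Sum>n\<le>j. D n * \<tau>)"
    by (simp add: sum_distrib_left mult.assoc)
  finally have "(\<Sum>n\<le>j. C n * \<tau>) + \<gamma> * (\<Sum>n\<le>j. E n * \<tau>) \<le> \<delta> / \<gamma> * (\<Sum>n\<le>j. D n * \<tau>)" .
  moreover have "(\<Sum>n\<le>j. C n * \<tau>) =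
      inner_closed N h (\<lambda>i. 1 / Gamma (2 - \<alpha> (real i * h)))
        (\<lambda>i. \<Sum>s\<le>j. caputo_weight \<tau> (\<alpha> (real i * h)) (j - s) * (y (s + 1) i)\<^sup>2)
      - inner_closed N h (\<lambda>i. (real (j + 1) * \<tau>) powr (1 - \<alpha> (real i * h)) / Gamma (2 - \<alpha> (real i * h)))
        (\<lambda>i. (y 0 i)\<^sup>2)"
    unfolding C_def using assms(2) by (intro sum_inner_closed_caputo) simp
  moreover have "inner_closed N h
        (\<lambda>i. (real (j + 1) * \<tau>) powr (1 - \<alpha> (real i * h)) / Gamma (2 - \<alpha> (real i * h)))
        (\<lambda>i. (y 0 i)\<^sup>2) =
      inner_closed N h
        (\<lambda>i. (real (j + 1) * \<tau>) powr (1 - \<alpha> (real i * h)) / Gamma (2 - \<alpha> (real i * h)))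
        (\<lambda>i. (u0 (real i * h))\<^sup>2)"
    using y by (intro inner_closed_cong) (simp add: solves_scheme_def)
  ultimately show "inner_closed N h
          (\<lambda>i. 1 / Gamma (2 - \<alpha> (real i * h)))
          (\<lambda>i. \<Sum>j' = 0..j. caputo_weight \<tau> (\<alpha> (real i * h)) (j - j') * (y (j' + 1) i)\<^sup>2)
        + \<gamma> * (\<Sum>j' = 0..j.
            (norm0_right_sq N h (diff_xbar h (weighted \<sigma> y j'))
             + (weighted \<sigma> y j' 0)\<^sup>2 + (weighted \<sigma> y j' N)\<^sup>2) * \<tau>)
        \<le> \<delta> / \<gamma> * (\<Sum>j' = 0..j.
            ((tilde h \<mu>1 f 0 (t_mid \<tau> j'))\<^sup>2 + (tilde h \<mu>2 f (real N * h) (t_mid \<tau> j'))\<^sup>2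
             + norm0_sq N h (phi N h f \<mu>1 \<mu>2 (t_mid \<tau> j'))) * \<tau>)
        + inner_closed N h
            (\<lambda>i. (real (j + 1) * \<tau>) powr (1 - \<alpha> (real i * h)) / Gamma (2 - \<alpha> (real i * h)))
            (\<lambda>i. (u0 (real i * h))\<^sup>2)"
    unfolding atLeast0AtMost E_def D_def by linarith
qed

section \<open>Linearity of the scheme and stability\<close>

lemma discrete_caputo_diff:
  "discrete_caputo \<tau> a (\<lambda>s. v s - w s) j = discrete_caputo \<tau> a v j - discrete_caputo \<tau> a w j"
  by (simp only: discrete_caputo_alt right_diff_distrib sum_subtractf)

lemma weighted_diff:
  "weighted \<sigma> (\<lambda>j i. y j i - y' j i) j = (\<lambda>i. weighted \<sigma> y j i - weighted \<sigma> y' j i)"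
  by (simp add: weighted_def fun_eq_iff algebra_simps)

lemma Lam_diff:
  "Lam N h k q \<beta>1 \<beta>2 t (\<lambda>i. v i - w i) i =
    Lam N h k q \<beta>1 \<beta>2 t v i - Lam N h k q \<beta>1 \<beta>2 t w i"
  by (simp add: Lam_def Let_def diff_x_def diff_xbar_def diff_divide_distrib add_divide_distrib
      algebra_simps)

lemma phi_diff:
  "phi N h (\<lambda>x t. f x t - f' x t) (\<lambda>t. \<mu>1 t - \<mu>1' t) (\<lambda>t. \<mu>2 t - \<mu>2' t) t i =
    phi N h f \<mu>1 \<mu>2 t i - phi N h f' \<mu>1' \<mu>2' t i"
  by (simp add: phi_def tilde_def diff_divide_distrib add_divide_distrib algebra_simps)

text \<open>The scheme is linear jointly in solution and data, so stability becomes the a priori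
  estimate applied to a difference of solutions.\<close>

lemma solves_scheme_diff:
  assumes "solves_scheme N j0 h \<tau> \<alpha> k q \<beta>1 \<beta>2 \<sigma> f \<mu>1 \<mu>2 u0 y"
    and "solves_scheme N j0 h \<tau> \<alpha> k q \<beta>1 \<beta>2 \<sigma> f' \<mu>1' \<mu>2' u0' y'"
  shows "solves_scheme N j0 h \<tau> \<alpha> k q \<beta>1 \<beta>2 \<sigma>
    (\<lambda>x t. f x t - f' x t) (\<lambda>t. \<mu>1 t - \<mu>1' t) (\<lambda>t. \<mu>2 t - \<mu>2' t) (\<lambda>x. u0 x - u0' x)
    (\<lambda>j i. y j i - y' j i)"
  using assms
  by (simp add: solves_scheme_def discrete_caputo_diff weighted_diff Lam_diff phi_diff)

text \<open>Stability is absolute because \<open>N\<close> and \<open>j0\<close> are arbitrary while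
  \<gamma> and \<delta> are determined by \<open>c1\<close>, \<beta>0 and \<open>l\<close>
  alone.\<close>

theorem theorem4:
  fixes l T h \<tau> c1 \<beta>0 \<sigma> \<gamma> \<delta> :: real
    and N j0 :: nat
    and \<alpha> \<beta>1 \<beta>2 \<mu>1 \<mu>2 u0 :: "real \<Rightarrow> real"
    and k q f :: "real \<Rightarrow> real \<Rightarrow> real"
    and y :: "nat \<Rightarrow> nat \<Rightarrow> real"
  assumes "l > 0" and "T > 0" and "N \<ge> 2" and "j0 \<ge> 1"
    and "h = l / real N" and "\<tau> = T / real j0"
    and "continuous_on {0..l} \<alpha>"
    and "\<And>x. x \<in> {0..l} \<Longrightarrow> 0 < \<alpha> x \<and> \<alpha> x < 1"
    and "c1 > 0"
    and "\<And>x t. x \<in> {0..l} \<Longrightarrow> t \<in> {0..T} \<Longrightarrow> k x t \<ge> c1"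
    and "\<And>x t. x \<in> {0..l} \<Longrightarrow> t \<in> {0..T} \<Longrightarrow> q x t \<ge> 0"
    and "\<beta>0 > 0"
    and "\<And>t. t \<in> {0..T} \<Longrightarrow> \<beta>1 t \<ge> \<beta>0"
    and "\<And>t. t \<in> {0..T} \<Longrightarrow> \<beta>2 t \<ge> \<beta>0"
    and "0 \<le> \<sigma>" and "\<sigma> \<le> 1"
    and "\<sigma> \<ge> 1 / (3 - 2 powr (1 - (MIN i\<in>{0..N}. \<alpha> (real i * h))))"
    and "\<gamma> = min c1 \<beta>0" and "\<delta> = max (1 + l) (l\<^sup>2)"
  shows "stable_on_grid N j0 h \<tau> \<alpha> k q \<beta>1 \<beta>2 \<sigma> \<gamma> \<delta> \<and>
         (solves_scheme N j0 h \<tau> \<alpha> k q \<beta>1 \<beta>2 \<sigma> f \<mu>1 \<mu>2 u0 y \<longrightarrow>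
          apriori_estimate N j0 h \<tau> \<alpha> \<sigma> \<gamma> \<delta> f \<mu>1 \<mu>2 u0 y)"
proof -
  have h: "0 < h" "l = real N * h" and \<tau>: "0 < \<tau>" "T = real j0 * \<tau>"
    using assms(1-6) by auto
  \<comment> \<open>The threshold decreases as the order grows, so the smallest nodal order is the
    worst case. That minimum is attained at a node and hence positive, which keeps the denominators
    positive.\<close>
  have \<sigma>: "1 / (3 - 2 powr (1 - \<alpha> (real i * h))) \<le> \<sigma>" if i: "i \<le> N" for i
  proof -
    define m where "m = (MIN i\<in>{0..N}. \<alpha> (real i * h))"
    have "m \<in> (\<lambda>i. \<alpha> (real i * h)) ` {0..N}"
      unfolding m_def by (intro Min_in) auto
    then obtain i0 where i0: "m = \<alpha> (real i0 * h)" "i0 \<in> {0..N}"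
      by (rule imageE)
    then have "real i0 * h \<in> {0..l}"
      using h by auto
    then have "0 < m"
      using assms(8) i0 by auto
    then have "2 powr (1 - m) < (2::real) powr 1"
      by (intro powr_less_mono) auto
    moreover have "m \<le> \<alpha> (real i * h)"
      unfolding m_def using i by (intro Min_le) auto
    then have "2 powr (1 - \<alpha> (real i * h)) \<le> (2::real) powr (1 - m)"
      by (intro powr_mono) auto
    ultimately have "1 / (3 - 2 powr (1 - \<alpha> (real i * h))) \<le> 1 / (3 - 2 powr (1 - m))"
      by (intro frac_le; simp only: powr_one zero_le_numeral; linarith)
    then show ?thesis
      using assms(17) unfolding m_def by linarith
  qed
  \<comment> \<open>Data and solution are generalized here so that the estimate also applies to
    differences of two solutions.\<close>
  have est: "apriori_estimate N j0 h \<tau> \<alpha> \<sigma> \<gamma> \<delta> f \<mu>1 \<mu>2 u0 y"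
    if "solves_scheme N j0 h \<tau> \<alpha> k q \<beta>1 \<beta>2 \<sigma> f \<mu>1 \<mu>2 u0 y" for f \<mu>1 \<mu>2 u0 y
  proof (rule apriori_estimate_if_solves_scheme[OF h(1) \<tau>(1) _ h(2) \<tau>(2) assms(8) _ _ _ _
        assms(16) \<sigma> _ assms(19) that])
    show "1 \<le> N" using assms(3) by simp
    show "0 < \<gamma>" using assms(9,12,18) by simp
    show "\<gamma> \<le> k x t" if "x \<in> {0..l}" "t \<in> {0..T}" for x t
      using assms(10)[OF that] assms(18) by simp
    show "0 \<le> q x t" if "x \<in> {0..l}" "t \<in> {0..T}" for x t
      using assms(11)[OF that] .
    show "\<gamma> \<le> \<beta>1 t" "\<gamma> \<le> \<beta>2 t" if "t \<in> {0..T}" for t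
      using assms(13,14)[OF that] assms(18) by simp_all
  qed auto
  then show ?thesis
    unfolding stable_on_grid_def by (blast intro: solves_scheme_diff)
qed

end
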